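(* Let $\psi:[0,\infty)\to\mathbb{R}$ be differentiable with $\psi'>0$, $\psi(0)=0$ and $\psi(x)\to\infty$ as $x\to\infty$, and let $\omega\in L^\infty(\mathbb{R}^+)$ be a weight function which is nowhere zero. If $f,g\in L^1_{\omega,\psi}(\mathbb{R}^+)$, then $f\ast_{\psi,\omega}g\in L^1_{\omega,\psi}(\mathbb{R}^+)$, and $$\mathcal{M}_{\psi,\omega}[f\ast_{\psi,\omega}g](p)=\mathcal{M}_{\psi,\omega}[f](p)\cdot\mathcal{M}_{\psi,\omega}[g](p)$$ for every $p\in\mathbb{C}$ for which the integrals defining $\mathcal{M}_{\psi,\omega}[f](p)$ and $\mathcal{M}_{\psi,\omega}[g](p)$ converge (absolutely, as Lebesgue integrals).
   Context: Here $\mathbb{R}^+=(0,\infty)$, and $\psi^{-1}$ denotes the inverse function of $\psi:[0,\infty)\to[0,\infty)$. The space $L^1_{\omega,\psi}(\mathbb{R}^+)$ consists of the measurable functions $f:\mathbb{R}^+\to\mathbb{C}$ with $$\|f\|_{L^1_{\omega,\psi}(\mathbb{R}^+)}=\int_0^\infty|\omega(x)f(x)|\,\psi'(x)\,dx<\infty.$$ The generalized ($\psi$-$\omega$-) Mellin transform is $$\mathcal{M}_{\psi,\omega}[f](p)=\int_0^\infty(\psi(x))^{p-1}\omega(x)f(x)\psi'(x)\,dx,$$ for those $p\in\mathbb{C}$ for which the integral converges. The generalized convolution of $f$ and $g$ is $$(f\ast_{\psi,\omega}g)(x)=\frac{1}{\omega(x)}\int_0^\infty\omega(s)f(s)\,\omega\!\left[\psi^{-1}\!\left(\frac{\psi(x)}{\psi(s)}\right)\right]g\!\left[\psi^{-1}\!\left(\frac{\psi(x)}{\psi(s)}\right)\right]\frac{\psi'(s)}{\psi(s)}\,ds,$$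 for those $x>0$ (almost every $x$ is required) for which the integral converges; functions are identified when equal almost everywhere. *)

theory Defs
  imports "HOL-Analysis.Analysis"
begin

text \<open>
  A function on the positive half-line is a total function on the reals whose values outside
  the half-line are never used. Every integral below is over the open interval \<open>{0<..}\<close>, where
  the two-sided derivative \<open>deriv \<psi>\<close> is the derivative of the restriction of \<open>\<psi>\<close> to \<open>{0..}\<close>.
  Measurability is Lebesgue measurability, and weights may be complex-valued.
\<close>

definition L_infty :: "(real \<Rightarrow> complex) set" where
  "L_infty = {\<omega> \<in> borel_measurable (lebesgue_on {0<..}).
     \<exists>C::real. AE x in lebesgue_on {0<..}. cmod (\<omega> x) \<le> C}"

definition L1_norm :: "(real \<Rightarrow> complex) \<Rightarrow> (real \<Rightarrow> real) \<Rightarrow> (real \<Rightarrow> complex) \<Rightarrow> ennreal" where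
  "L1_norm \<omega> \<psi> f = (\<integral>\<^sup>+x\<in>{0<..}. ennreal (cmod (\<omega> x * f x) * deriv \<psi> x) \<partial>lebesgue)"

text \<open>Elements are functions rather than classes modulo almost-everywhere equality.\<close>

definition L1_space :: "(real \<Rightarrow> complex) \<Rightarrow> (real \<Rightarrow> real) \<Rightarrow> (real \<Rightarrow> complex) set" where
  "L1_space \<omega> \<psi> = {f \<in> borel_measurable (lebesgue_on {0<..}). L1_norm \<omega> \<psi> f < \<infinity>}"

definition mellin_integrand ::
  "(real \<Rightarrow> real) \<Rightarrow> (real \<Rightarrow> complex) \<Rightarrow> (real \<Rightarrow> complex) \<Rightarrow> complex \<Rightarrow> real \<Rightarrow> complex" where
  "mellin_integrand \<psi> \<omega> f p x =
     complex_of_real (\<psi> x) powr (p - 1) * \<omega> x * f x * complex_of_real (deriv \<psi> x)"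

definition mellin_converges ::
  "(real \<Rightarrow> real) \<Rightarrow> (real \<Rightarrow> complex) \<Rightarrow> (real \<Rightarrow> complex) \<Rightarrow> complex \<Rightarrow> bool" where
  "mellin_converges \<psi> \<omega> f p \<longleftrightarrow> set_integrable lebesgue {0<..} (mellin_integrand \<psi> \<omega> f p)"

text \<open>Meaningful only where \<open>mellin_converges\<close> holds; a divergent integral has value 0.\<close>

definition mellin ::
  "(real \<Rightarrow> real) \<Rightarrow> (real \<Rightarrow> complex) \<Rightarrow> (real \<Rightarrow> complex) \<Rightarrow> complex \<Rightarrow> complex" where
  "mellin \<psi> \<omega> f p = (LINT x:{0<..}|lebesgue. mellin_integrand \<psi> \<omega> f p x)"

definition gconv_integrand ::
  "(real \<Rightarrow> real) \<Rightarrow> (real \<Rightarrow> complex) \<Rightarrow> (real \<Rightarrow> complex) \<Rightarrow> (real \<Rightarrow> complex) \<Rightarrow>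
   real \<Rightarrow> real \<Rightarrow> complex" where
  "gconv_integrand \<psi> \<omega> f g x s =
     \<omega> s * f s * \<omega> (inv_into {0..} \<psi> (\<psi> x / \<psi> s)) * g (inv_into {0..} \<psi> (\<psi> x / \<psi> s))
       * complex_of_real (deriv \<psi> s / \<psi> s)"

definition gconv_converges ::
  "(real \<Rightarrow> real) \<Rightarrow> (real \<Rightarrow> complex) \<Rightarrow> (real \<Rightarrow> complex) \<Rightarrow> (real \<Rightarrow> complex) \<Rightarrow>
   real \<Rightarrow> bool" where
  "gconv_converges \<psi> \<omega> f g x \<longleftrightarrow> set_integrable lebesgue {0<..} (gconv_integrand \<psi> \<omega> f g x)"

text \<open>Meaningful only where \<open>gconv_converges\<close> holds; elsewhere the value is 0.\<close>

definition gconv ::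
  "(real \<Rightarrow> real) \<Rightarrow> (real \<Rightarrow> complex) \<Rightarrow> (real \<Rightarrow> complex) \<Rightarrow> (real \<Rightarrow> complex) \<Rightarrow>
   real \<Rightarrow> complex" where
  "gconv \<psi> \<omega> f g x = 1 / \<omega> x * (LINT s:{0<..}|lebesgue. gconv_integrand \<psi> \<omega> f g x s)"

end

theory Submission imports Defs begin

text \<open>
  The substitution \<open>u = \<psi> x\<close> turns \<open>\<omega> f\<close> into a function \<open>F\<close> of \<open>u\<close> whose classical Mellin transform is
  that of \<open>f\<close>, and turns the generalized convolution into the multiplicative convolution
  \<open>\<integral> F v * G (u / v) / v dv\<close>. For integrable \<open>F\<close> and \<open>G\<close>, Fubini and the scaling \<open>u = v w\<close> show that this
  is integrable with integral \<open>(\<integral> F) * (\<integral> G)\<close>. Since \<open>u powr (p - 1)\<close> is multiplicative in \<open>u\<close>, the factor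
  can be moved inside the convolution, so the same fact gives the product formula for every \<open>p\<close>;
  the case \<open>p = 1\<close> is the membership in the weighted space.
\<close>

section \<open>Null sets and changes of variables for Lebesgue integrals\<close>

text \<open>Lebesgue measure is complete, so a change on a null set preserves measurability together
  with integrability; the equivalence therefore holds for arbitrary \<open>f\<close> and
  \<open>g\<close>. The spike lemmas of the gauge integral supply both parts.\<close>

lemma set_integral_lebesgue_cong_AE:
  fixes f g :: "'a::euclidean_space \<Rightarrow> 'b::euclidean_space"
  assumes "AE x in lebesgue. x \<in> S \<longrightarrow> f x = g x"
  shows "set_integrable lebesgue S f \<longleftrightarrow> set_integrable lebesgue S g"
    and "(LINT x:S|lebesgue. f x) = (LINT x:S|lebesgue. g x)"
proof -
  have N: "negligible {x. \<not> (x \<in> S \<longrightarrow> f x = g x)}"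
    using assms by (simp add: negligible_iff_null_sets AE_iff_null_sets completion.complete2
        eventually_ae_filter) (meson completion.complete2)
  show *: "set_integrable lebesgue S f \<longleftrightarrow> set_integrable lebesgue S g"
    by (rule absolutely_integrable_spike_eq[OF N]) auto
  show "(LINT x:S|lebesgue. f x) = (LINT x:S|lebesgue. g x)"
  proof (cases "set_integrable lebesgue S f")
    case True
    have "integral S f = integral S g"
      by (rule integral_spike[OF N]) auto
    then show ?thesis
      using True * by (simp add: set_lebesgue_integral_eq_integral)
  next
    \<comment> \<open>Neither function is integrable, so both integrals have the default value
      0.\<close>
    case False
    then show ?thesis
      using * by (simp add: set_lebesgue_integral_def set_integrable_def not_integrable_integral_eq)
  qed
qed

text \<open>This is the change of variables formula with the absolute value removed by
  \<open>\<phi>' x \<ge> 0\<close>. The second equation also covers divergence, where both sides are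
  0 by default.\<close>

lemma set_integral_substitution:
  fixes f :: "real \<Rightarrow> complex" and \<phi> \<phi>' :: "real \<Rightarrow> real"
  assumes "S \<in> sets lebesgue" "inj_on \<phi> S"
    and "\<And>x. x \<in> S \<Longrightarrow> (\<phi> has_real_derivative \<phi>' x) (at x)"
    and "\<And>x. x \<in> S \<Longrightarrow> \<phi>' x \<ge> 0"
    and eq: "\<And>x. x \<in> S \<Longrightarrow> h x = f (\<phi> x) * complex_of_real (\<phi>' x)"
  shows "set_integrable lebesgue S h \<longleftrightarrow> set_integrable lebesgue (\<phi> ` S) f"
    and "(LINT x:S|lebesgue. h x) = (LINT u:\<phi> ` S|lebesgue. f u)"
proof -
  have der: "\<And>x. x \<in> S \<Longrightarrow> (\<phi> has_field_derivative \<phi>' x) (at x within S)"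
    using assms(3) has_field_derivative_at_within by blast
  have h: "h x = \<bar>\<phi>' x\<bar> *\<^sub>R f (\<phi> x)" if "x \<in> S" for x
    using that assms(4) eq by (simp add: scaleR_conv_of_real mult.commute)
  note cov = has_absolute_integral_change_of_variables_real[OF assms(1) der assms(2), of f]
  have h_int: "set_integrable lebesgue S h \<longleftrightarrow> set_integrable lebesgue S (\<lambda>x. \<bar>\<phi>' x\<bar> *\<^sub>R f (\<phi> x))"
    using h assms(1) by (intro set_integrable_cong) auto
  have h_eq: "integral S h = integral S (\<lambda>x. \<bar>\<phi>' x\<bar> *\<^sub>R f (\<phi> x))"
    using h by (intro Henstock_Kurzweil_Integration.integral_cong) auto
  show int: "set_integrable lebesgue S h \<longleftrightarrow> set_integrable lebesgue (\<phi> ` S) f"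
    unfolding h_int using cov by blast
  show "(LINT x:S|lebesgue. h x) = (LINT u:\<phi> ` S|lebesgue. f u)"
  proof (cases "set_integrable lebesgue S h")
    case True
    then have "integral S h = integral (\<phi> ` S) f"
      using cov h_int h_eq by metis
    then show ?thesis
      using True int by (simp add: set_lebesgue_integral_eq_integral)
  next
    case False
    then show ?thesis
      using int by (simp add: set_lebesgue_integral_def set_integrable_def not_integrable_integral_eq)
  qed
qed

text \<open>Apply the change of variables to the indicator \<open>I\<close> of the set where
  \<open>P\<close> fails. Its integral over the image is 0, so the nonnegative pullback
  \<open>\<bar>\<phi>' x\<bar> *\<^sub>R I (\<phi> x)\<close> has integral 0 and vanishes almost
  everywhere; as \<open>\<phi>' x \<noteq> 0\<close>, this forces \<open>P (\<phi> x)\<close>.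
  Either sign of the derivative is allowed because \<open>reciprocal_AE\<close> uses a decreasing
  map.\<close>

lemma AE_substitution:
  fixes \<phi> \<phi>' :: "real \<Rightarrow> real"
  assumes "S \<in> sets lebesgue" "inj_on \<phi> S"
    and der: "\<And>x. x \<in> S \<Longrightarrow> (\<phi> has_real_derivative \<phi>' x) (at x)"
    and nz: "\<And>x. x \<in> S \<Longrightarrow> \<phi>' x \<noteq> 0"
    and "AE u in lebesgue. u \<in> \<phi> ` S \<longrightarrow> P u"
  shows "AE x in lebesgue. x \<in> S \<longrightarrow> P (\<phi> x)"
proof -
  define I :: "real \<Rightarrow> real" where "I u = (if P u then 0 else 1)" for u
  have I_AE: "AE u in lebesgue. u \<in> \<phi> ` S \<longrightarrow> I u = 0"
    using assms(5) by (auto simp: I_def)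
  have "set_integrable lebesgue (\<phi> ` S) I"
    by (subst set_integral_lebesgue_cong_AE(1)[OF I_AE]) (simp add: set_integrable_def)
  moreover have "(LINT u:\<phi> ` S|lebesgue. I u) = 0"
    by (subst set_integral_lebesgue_cong_AE(2)[OF I_AE]) (simp add: set_lebesgue_integral_def)
  ultimately have I0: "set_integrable lebesgue (\<phi> ` S) I" "integral (\<phi> ` S) I = 0"
    by (simp_all add: set_lebesgue_integral_eq_integral)
  have der': "\<And>x. x \<in> S \<Longrightarrow> (\<phi> has_field_derivative \<phi>' x) (at x within S)"
    using der has_field_derivative_at_within by blast
  have J: "set_integrable lebesgue S (\<lambda>x. \<bar>\<phi>' x\<bar> *\<^sub>R I (\<phi> x))"
    "integral S (\<lambda>x. \<bar>\<phi>' x\<bar> *\<^sub>R I (\<phi> x)) = 0"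
    using has_absolute_integral_change_of_variables_real[OF assms(1) der' assms(2), of I 0] I0
    by blast+
  then have "(LINT x:S|lebesgue. \<bar>\<phi>' x\<bar> *\<^sub>R I (\<phi> x)) = 0"
    by (simp add: set_lebesgue_integral_eq_integral)
  then have "AE x in lebesgue. indicator S x *\<^sub>R (\<bar>\<phi>' x\<bar> *\<^sub>R I (\<phi> x)) = 0"
    using J(1) unfolding set_lebesgue_integral_def set_integrable_def
    by (subst (asm) integral_nonneg_eq_0_iff_AE) (auto simp: I_def)
  then show ?thesis
    by eventually_elim (use nz in \<open>force simp: I_def indicator_def split: if_splits\<close>)
qed

text \<open>
  If \<open>G\<close> is only Lebesgue measurable, \<open>G (u / v)\<close> need not be measurable for the product sigma-algebra,
  so Fubini is applied to Borel representatives.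
\<close>
lemma lebesgue_integrable_borel_representative:
  fixes f :: "real \<Rightarrow> complex"
  assumes "set_integrable lebesgue {0<..} f"
  obtains f' where "integrable lborel f'" "\<And>x. x \<le> 0 \<Longrightarrow> f' x = 0"
    "AE x in lebesgue. x \<in> {0<..} \<longrightarrow> f x = f' x"
proof -
  define f0 where "f0 x = indicator {0<..} x *\<^sub>R f x" for x
  have f0: "integrable lebesgue f0"
    using assms by (simp add: set_integrable_def f0_def[abs_def])
  then have [measurable]: "f0 \<in> borel_measurable lebesgue" by simp
  obtain r where r [measurable]: "r \<in> borel_measurable lborel" "AE x in lborel. Re (f0 x) = r x"
    using completion_ex_borel_measurable_real[of "\<lambda>x. Re (f0 x)" lborel] by auto
  obtain i where i [measurable]: "i \<in> borel_measurable lborel" "AE x in lborel. Im (f0 x) = i x"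
    using completion_ex_borel_measurable_real[of "\<lambda>x. Im (f0 x)" lborel] by auto
  \<comment> \<open>Extension by zero to the whole line allows Fubini and the affine substitution to
    be used for \<open>lborel\<close> without restricting domains.\<close>
  define f' where "f' x = indicator {0<..} x *\<^sub>R Complex (r x) (i x)" for x
  have f'_eq: "f' = (\<lambda>x. indicator {0<..} x *\<^sub>R (complex_of_real (r x) + \<i> * complex_of_real (i x)))"
    by (simp add: f'_def[abs_def] Complex_eq)
  have meas: "f' \<in> borel_measurable lborel"
    unfolding f'_eq using r(1) i(1) by measurable
  have "AE x in lborel. f0 x = f' x"
    using r(2) i(2) by eventually_elim (auto simp: f'_def f0_def indicator_def complex_eq_iff)
  then have ae: "AE x in lebesgue. f0 x = f' x"
    by (rule AE_completion)
  have "integrable lebesgue f'"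
    using f0 ae meas integrable_cong_AE[of f0 lebesgue f'] measurable_completion[OF meas] by simp
  then have "integrable lborel f'"
    using meas integrable_completion by blast
  moreover have "AE x in lebesgue. x \<in> {0<..} \<longrightarrow> f x = f' x"
    using ae by eventually_elim (auto simp: f0_def)
  ultimately show thesis
    using that by (simp add: f'_def)
qed

section \<open>Multiplicative convolution on the positive half-line\<close>

text \<open>For fixed \<open>v > 0\<close> the scaling \<open>u = v w\<close> cancels the factor
  \<open>1 / v\<close>, so integrating \<open>K v\<close> or its norm over \<open>u\<close>
  separates the variables. The norm version gives the integrability criterion of Fubini, the other
  one the value.\<close>

lemma mult_convolution_kernel:
  fixes F G :: "real \<Rightarrow> complex"
  assumes F: "integrable lborel F" and G: "integrable lborel G" and F0: "\<And>x. x \<le> 0 \<Longrightarrow> F x = 0"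
  defines "K \<equiv> \<lambda>v u. F v * G (u / v) / complex_of_real v"
  shows "integrable (lborel \<Otimes>\<^sub>M lborel) (\<lambda>(v, u). K v u)"
    and "(LINT v|lborel. LINT u|lborel. K v u) = (LINT v|lborel. F v) * (LINT w|lborel. G w)"
proof -
  have [measurable]: "F \<in> borel_measurable borel" "G \<in> borel_measurable borel"
    using F G by (auto dest: borel_measurable_integrable)
  have scale: "integrable lborel (K v)"
    "(LINT u|lborel. K v u) = F v * (LINT w|lborel. G w)"
    "(LINT u|lborel. norm (K v u)) = norm (F v) * (LINT w|lborel. norm (G w))" for v
  proof (atomize(full), cases "v > 0")
    \<comment> \<open>Here \<open>F v = 0\<close>, so \<open>K v\<close> is identically zero and all
      three claims are trivial.\<close>
    case False
    then show "integrable lborel (K v) \<and> (LINT u|lborel. K v u) = F v * (LINT w|lborel. G w) \<and>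
      (LINT u|lborel. norm (K v u)) = norm (F v) * (LINT w|lborel. norm (G w))"
      using F0[of v] by (simp add: K_def)
  next
    case True
    have "integrable lborel (\<lambda>u. G (0 + (1 / v) * u))"
      using True by (intro lborel_integrable_real_affine G) auto
    then have int: "integrable lborel (\<lambda>u. G (u / v))" by simp
    have eq: "(LINT w|lborel. G w) = (1 / v) *\<^sub>R (LINT u|lborel. G (u / v))"
      using lborel_integral_real_affine[of "1 / v" G 0] True by simp
    have eq': "(LINT w|lborel. norm (G w)) = (1 / v) *\<^sub>R (LINT u|lborel. norm (G (u / v)))"
      using lborel_integral_real_affine[of "1 / v" "\<lambda>w. norm (G w)" 0] True by simp
    have K: "K v = (\<lambda>u. F v / complex_of_real v * G (u / v))"
      by (simp add: K_def fun_eq_iff)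
    show "integrable lborel (K v) \<and> (LINT u|lborel. K v u) = F v * (LINT w|lborel. G w) \<and>
      (LINT u|lborel. norm (K v u)) = norm (F v) * (LINT w|lborel. norm (G w))"
      unfolding K using True int
      by (simp add: eq eq' norm_mult norm_divide scaleR_conv_of_real)
  qed
  show "integrable (lborel \<Otimes>\<^sub>M lborel) (\<lambda>(v, u). K v u)"
  proof (rule lborel_pair.Fubini_integrable)
    show "(\<lambda>(v, u). K v u) \<in> borel_measurable (lborel \<Otimes>\<^sub>M lborel)"
      unfolding K_def by measurable
    show "integrable lborel (\<lambda>v. LINT u|lborel. norm (case (v, u) of (v, u) \<Rightarrow> K v u))"
      using F by (simp add: scale)
    show "AE v in lborel. integrable lborel (\<lambda>u. case (v, u) of (v, u) \<Rightarrow> K v u)"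
      by (simp add: scale)
  qed
  show "(LINT v|lborel. LINT u|lborel. K v u) = (LINT v|lborel. F v) * (LINT w|lborel. G w)"
    by (simp add: scale)
qed

text \<open>This is convolution on the multiplicative group of positive reals, with Haar measure
  \<open>dv / v\<close>.\<close>

definition mult_convolution :: "(real \<Rightarrow> complex) \<Rightarrow> (real \<Rightarrow> complex) \<Rightarrow> real \<Rightarrow> complex" where
  "mult_convolution F G u = (LINT v:{0<..}|lebesgue. F v * G (u / v) / complex_of_real v)"

text \<open>The map \<open>v \<mapsto> u / v\<close> is an involution of the half-line with
  nonvanishing derivative, so preimages of null sets are null. This permits replacing
  \<open>G\<close> by a representative inside the convolution integral at a fixed
  \<open>u\<close>.\<close>

lemma reciprocal_AE:
  fixes u :: real
  assumes "u > 0" and "AE w in lebesgue. w \<in> {0<..} \<longrightarrow> P w"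
  shows "AE v in lebesgue. v \<in> {0<..} \<longrightarrow> P (u / v)"
proof -
  have "bij_betw (\<lambda>v. u / v) {0<..} {0<..}"
    using \<open>u > 0\<close> by (intro bij_betw_byWitness[where f' = "\<lambda>v. u / v"]) (auto simp: field_simps)
  then have *: "inj_on (\<lambda>v. u / v) {0<..}" "(\<lambda>v. u / v) ` {0<..} = {0<..}"
    by (auto simp: bij_betw_def)
  show ?thesis
  proof (rule AE_substitution[where \<phi>' = "\<lambda>v. - u / v\<^sup>2" and \<phi> = "\<lambda>v. u / v"])
    show "((\<lambda>v. u / v) has_real_derivative - u / v\<^sup>2) (at v)" if "v \<in> {0<..}" for v
      using that by (auto intro!: derivative_eq_intros simp: power2_eq_square field_simps)
  qed (use * assms in auto)
qed


text \<open>Everything is transferred to the kernel \<open>K\<close> of Borel representatives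
  extended by zero. Integrability of \<open>K\<close> on the plane then gives almost every section,
  the integrability of \<open>C\<close>, and the total integral by exchanging the order.\<close>

lemma mult_convolution_integrable:
  assumes F: "set_integrable lebesgue {0<..} F" and G: "set_integrable lebesgue {0<..} G"
  shows "AE u\<in>{0<..} in lebesgue.
      set_integrable lebesgue {0<..} (\<lambda>v. F v * G (u / v) / complex_of_real v)"
    and "set_integrable lebesgue {0<..} (mult_convolution F G)"
    and "(LINT u:{0<..}|lebesgue. mult_convolution F G u) =
      (LINT v:{0<..}|lebesgue. F v) * (LINT w:{0<..}|lebesgue. G w)"
proof -
  obtain F' where F': "integrable lborel F'" and F'0: "\<And>x. x \<le> 0 \<Longrightarrow> F' x = 0"
    and FF': "AE x\<in>{0<..} in lebesgue. F x = F' x"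
    using lebesgue_integrable_borel_representative[OF F] by blast
  obtain G' where G': "integrable lborel G'" and G'0: "\<And>x. x \<le> 0 \<Longrightarrow> G' x = 0"
    and GG': "AE x\<in>{0<..} in lebesgue. G x = G' x"
    using lebesgue_integrable_borel_representative[OF G] by blast
  have [measurable]: "F' \<in> borel_measurable borel" "G' \<in> borel_measurable borel"
    using F' G' by (auto dest: borel_measurable_integrable)
  \<comment> \<open>This links integrals over the half-line for \<open>lebesgue\<close> with those
    over the line for \<open>lborel\<close>, where Fubini is applied.\<close>
  have half_line: "(LINT x:{0<..}|lebesgue. h x) = (LINT x|lborel. h x)"
    "set_integrable lebesgue {0<..} h \<longleftrightarrow> integrable lborel h"
    if "h \<in> borel_measurable borel" "\<And>x. x \<le> 0 \<Longrightarrow> h x = 0" for h :: "real \<Rightarrow> complex"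
  proof -
    have "(\<lambda>x. indicator {0<..} x *\<^sub>R h x) = h"
      using that(2) by (auto simp: fun_eq_iff indicator_def)
    then show "(LINT x:{0<..}|lebesgue. h x) = (LINT x|lborel. h x)"
      "set_integrable lebesgue {0<..} h \<longleftrightarrow> integrable lborel h"
      using that(1) by (simp_all add: set_lebesgue_integral_def set_integrable_def
          integral_completion integrable_completion)
  qed
  define K where "K v u = F' v * G' (u / v) / complex_of_real v" for v u
  have K_meas: "(\<lambda>v. K v u) \<in> borel_measurable borel" for u
    unfolding K_def by measurable
  have K0: "K v u = 0" if "v \<le> 0 \<or> u \<le> 0" for v u
    using that F'0[of v] G'0[of "u / v"] by (cases "v > 0") (auto simp: K_def divide_le_0_iff)
  note K_int = mult_convolution_kernel[OF F' G' F'0, folded K_def]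
  define C where "C u = (LINT v|lborel. K v u)" for u
  have C_int: "integrable lborel C"
    using lborel_pair.integrable_snd[OF K_int(1)] by (simp add: C_def[abs_def])
  have C0: "C u = 0" if "u \<le> 0" for u
    using that K0 by (simp add: C_def)
  \<comment> \<open>The exceptional set in \<open>v\<close> may depend on \<open>u\<close>, but it
    is null for every \<open>u > 0\<close>. Hence \<open>conv\<close> below holds at every positive
    \<open>u\<close>.\<close>
  have eq: "AE v\<in>{0<..} in lebesgue. F v * G (u / v) / complex_of_real v = K v u" if "u > 0" for u
    using FF' reciprocal_AE[OF that GG'] by eventually_elim (simp add: K_def)
  have conv: "mult_convolution F G u = C u" if "u > 0" for u
    unfolding mult_convolution_def set_integral_lebesgue_cong_AE(2)[OF eq[OF that]] C_def
    using K0 by (intro half_line K_meas) auto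
  have conv_AE: "AE u\<in>{0<..} in lebesgue. mult_convolution F G u = C u"
    using conv by simp
  have "AE u in lborel. integrable lborel (\<lambda>v. K v u)"
    using lborel_pair.AE_integrable_snd[OF K_int(1)] .
  then have "AE u in lebesgue. integrable lborel (\<lambda>v. K v u)"
    by (rule AE_completion)
  then show "AE u\<in>{0<..} in lebesgue.
      set_integrable lebesgue {0<..} (\<lambda>v. F v * G (u / v) / complex_of_real v)"
  proof eventually_elim
    case (elim u)
    then show ?case
      using set_integral_lebesgue_cong_AE(1)[OF eq] half_line(2)[OF K_meas[of u]] K0 by auto
  qed
  have C_meas: "C \<in> borel_measurable borel"
    using C_int by (auto dest: borel_measurable_integrable)
  show "set_integrable lebesgue {0<..} (mult_convolution F G)"
    unfolding set_integral_lebesgue_cong_AE(1)[OF conv_AE]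
    using half_line(2)[OF C_meas C0] C_int by simp
  have "(LINT u:{0<..}|lebesgue. mult_convolution F G u) = (LINT u|lborel. C u)"
    unfolding set_integral_lebesgue_cong_AE(2)[OF conv_AE]
    using half_line(1)[OF C_meas C0] by simp
  also have "\<dots> = (LINT v|lborel. LINT u|lborel. K v u)"
    unfolding C_def using lborel_pair.Fubini_integral[OF K_int(1)] by simp
  also have "\<dots> = (LINT v|lborel. F' v) * (LINT w|lborel. G' w)"
    by (rule K_int(2))
  also have "(LINT v|lborel. F' v) = (LINT v:{0<..}|lebesgue. F v)"
    using set_integral_lebesgue_cong_AE(2)[OF FF'] half_line(1)[of F'] F'0 by simp
  also have "(LINT v|lborel. G' v) = (LINT v:{0<..}|lebesgue. G v)"
    using set_integral_lebesgue_cong_AE(2)[OF GG'] half_line(1)[of G'] G'0 by simp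
  finally show "(LINT u:{0<..}|lebesgue. mult_convolution F G u) =
      (LINT v:{0<..}|lebesgue. F v) * (LINT w:{0<..}|lebesgue. G w)" .
qed

text \<open>Since \<open>v\<close> and \<open>u / v\<close> are positive, the principal branch
  satisfies \<open>v powr z * (u / v) powr z = u powr z\<close>, a factor independent of
  \<open>v\<close>.\<close>

lemma mult_convolution_powr:
  assumes "u > 0"
  shows "mult_convolution (\<lambda>v. complex_of_real v powr z * F v) (\<lambda>w. complex_of_real w powr z * G w) u
    = complex_of_real u powr z * mult_convolution F G u"
proof -
  have "complex_of_real v powr z * F v * (complex_of_real (u / v) powr z * G (u / v)) / complex_of_real v
      = complex_of_real u powr z * (F v * G (u / v) / complex_of_real v)" if "v > 0" for v
  proof -
    have "complex_of_real v powr z * complex_of_real (u / v) powr z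
        = (complex_of_real v * complex_of_real (u / v)) powr z"
      using that assms by (subst powr_times_real) auto
    also have "complex_of_real v * complex_of_real (u / v) = complex_of_real u"
      using that by simp
    finally show ?thesis by (metis (no_types, opaque_lifting) mult.assoc mult.commute times_divide_eq_right)
  qed
  then show ?thesis
    unfolding mult_convolution_def set_integral_mult_right[symmetric]
    by (intro set_lebesgue_integral_cong) auto
qed

section \<open>The substitution \<open>u = \<psi> x\<close> on the positive half-line\<close>

context
  fixes \<psi> :: "real \<Rightarrow> real"
  assumes deriv: "\<forall>x\<ge>0. \<exists>d>0. (\<psi> has_real_derivative d) (at x within {0..})"
    and zero: "\<psi> 0 = 0"
    and at_top: "filterlim \<psi> at_top at_top"
begin

lemma psi_deriv:
  assumes "x > 0"
  shows "(\<psi> has_real_derivative deriv \<psi> x) (at x)" and "deriv \<psi> x > 0"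
proof -
  obtain d where d: "d > 0" "(\<psi> has_real_derivative d) (at x within {0..})"
    using deriv assms by (meson less_imp_le)
  \<comment> \<open>Passing to the open half-line turns the derivative within a set into the
    two-sided one that \<open>deriv\<close> denotes.\<close>
  have "(\<psi> has_real_derivative d) (at x within {0<..})"
    using d(2) by (rule has_field_derivative_subset) auto
  then have "(\<psi> has_real_derivative d) (at x)"
    using assms at_within_open[of x "{0<..}"] by simp
  moreover from this have "deriv \<psi> x = d"
    by (rule DERIV_imp_deriv)
  ultimately show "(\<psi> has_real_derivative deriv \<psi> x) (at x)" "deriv \<psi> x > 0"
    using d(1) by simp_all
qed

lemma psi_continuous: "continuous_on {0..} \<psi>"
proof -
  obtain \<psi>' where "\<And>x. x \<in> {0..} \<Longrightarrow> (\<psi> has_real_derivative \<psi>' x) (at x within {0..})"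
    using deriv by (metis atLeast_iff)
  then show ?thesis
    by (rule DERIV_continuous_on)
qed

lemma psi_strict_mono:
  assumes "0 \<le> x" "x < y"
  shows "\<psi> x < \<psi> y"
proof (rule DERIV_pos_imp_increasing_open[OF assms(2)])
  show "\<exists>d. (\<psi> has_real_derivative d) (at t) \<and> d > 0" if "x < t" for t
    using that assms(1) psi_deriv[of t] by force
  show "continuous_on {x..y} \<psi>"
    using psi_continuous by (rule continuous_on_subset) (use assms(1) in auto)
qed

lemma psi_inj: "inj_on \<psi> {0..}"
proof (rule linorder_inj_onI')
  show "\<psi> x \<noteq> \<psi> y" if "x \<in> {0..}" "x < y" for x y
    using psi_strict_mono[of x y] that by simp
qed

lemma psi_pos: "x > 0 \<Longrightarrow> \<psi> x > 0"
  using psi_strict_mono[of 0 x] zero by simp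

lemma psi_image: "\<psi> ` {0<..} = {0<..}"
proof
  show "\<psi> ` {0<..} \<subseteq> {0<..}" using psi_pos by auto
  show "{0<..} \<subseteq> \<psi> ` {0<..}"
  proof
    fix u :: real assume u: "u \<in> {0<..}"
    have "eventually (\<lambda>b. u \<le> \<psi> b \<and> 0 \<le> b) at_top"
      using at_top by (simp add: filterlim_at_top eventually_conj_iff eventually_ge_at_top)
    then obtain b where b: "u \<le> \<psi> b" "0 \<le> b"
      by (auto dest: eventually_happens)
    have "\<exists>x\<ge>0. x \<le> b \<and> \<psi> x = u"
      by (rule IVT') (use u b zero in \<open>auto intro: continuous_on_subset[OF psi_continuous]\<close>)
    then obtain x where "x \<ge> 0" "\<psi> x = u"
      by blast
    moreover from this u zero have "x \<noteq> 0"
      by auto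
    ultimately show "u \<in> \<psi> ` {0<..}"
      by auto
  qed
qed

abbreviation psi_inv :: "real \<Rightarrow> real" where
  "psi_inv \<equiv> inv_into {0..} \<psi>"

lemma psi_inv_psi: "x > 0 \<Longrightarrow> psi_inv (\<psi> x) = x"
  using psi_inj by (simp add: inv_into_f_f)

lemma psi_psi_inv: "u > 0 \<Longrightarrow> psi_inv u > 0 \<and> \<psi> (psi_inv u) = u"
  using psi_image psi_inv_psi by (metis (no_types, lifting) greaterThan_iff imageE)

lemma psi_substitution:
  assumes "\<And>x. x > 0 \<Longrightarrow> h x = k (\<psi> x) * complex_of_real (deriv \<psi> x)"
  shows "set_integrable lebesgue {0<..} h \<longleftrightarrow> set_integrable lebesgue {0<..} k"
    and "(LINT x:{0<..}|lebesgue. h x) = (LINT u:{0<..}|lebesgue. k u)"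
proof -
  have inj: "inj_on \<psi> {0<..}"
    using psi_inj by (rule inj_on_subset) auto
  note * = set_integral_substitution[of "{0<..}" \<psi> "deriv \<psi>" h k, OF _ inj, unfolded psi_image]
  show "set_integrable lebesgue {0<..} h \<longleftrightarrow> set_integrable lebesgue {0<..} k"
    using assms psi_deriv by (intro *) (auto intro: less_imp_le)
  show "(LINT x:{0<..}|lebesgue. h x) = (LINT u:{0<..}|lebesgue. k u)"
    using assms psi_deriv by (intro *) (auto intro: less_imp_le)
qed

lemma psi_AE:
  assumes "AE u\<in>{0<..} in lebesgue. P u"
  shows "AE x\<in>{0<..} in lebesgue. P (\<psi> x)"
proof (rule AE_substitution)
  show "inj_on \<psi> {0<..}"
    using psi_inj by (rule inj_on_subset) auto
  show "(\<psi> has_real_derivative deriv \<psi> x) (at x)" "deriv \<psi> x \<noteq> 0" if "x \<in> {0<..}" for x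
    using psi_deriv[of x] that by auto
qed (use assms psi_image in auto)

text \<open>The derivative may be discontinuous, but it is the pointwise limit of continuous
  difference quotients. The forward steps \<open>1 / real (Suc n)\<close> keep the argument where
  \<psi> is known to be continuous.\<close>

lemma psi_deriv_measurable: "deriv \<psi> \<in> borel_measurable (lebesgue_on {0<..})"
proof (rule borel_measurable_LIMSEQ_real)
  fix x :: real assume "x \<in> space (lebesgue_on {0<..})"
  then have "(\<psi> has_real_derivative deriv \<psi> x) (at x)"
    using psi_deriv by simp
  then have "((\<lambda>h. (\<psi> (x + h) - \<psi> x) / h) \<longlongrightarrow> deriv \<psi> x) (at 0)"
    by (simp add: DERIV_def)
  moreover have "filterlim (\<lambda>n. 1 / real (Suc n)) (at 0) sequentially"
    using LIMSEQ_inverse_real_of_nat by (auto simp: filterlim_at inverse_eq_divide simp del: of_nat_Suc)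
  ultimately show "(\<lambda>n. (\<psi> (x + 1 / real (Suc n)) - \<psi> x) / (1 / real (Suc n))) \<longlonglongrightarrow> deriv \<psi> x"
    by (rule filterlim_compose)
next
  fix n
  have "continuous_on {0<..} (\<lambda>x. (\<psi> (x + 1 / real (Suc n)) - \<psi> x) / (1 / real (Suc n)))"
    by (intro continuous_intros continuous_on_subset[OF psi_continuous]
        continuous_on_compose2[OF psi_continuous]) auto
  then show "(\<lambda>x. (\<psi> (x + 1 / real (Suc n)) - \<psi> x) / (1 / real (Suc n)))
      \<in> borel_measurable (lebesgue_on {0<..})"
    by (rule continuous_imp_measurable_on_sets_lebesgue) simp
qed

section \<open>Passage to the variable \<open>u\<close>\<close>

text \<open>This is the function \<open>F\<close> of the overview. It carries no factor
  \<open>deriv \<psi>\<close>, which the substitution absorbs.\<close>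

definition transport :: "(real \<Rightarrow> complex) \<Rightarrow> (real \<Rightarrow> complex) \<Rightarrow> real \<Rightarrow> complex" where
  "transport \<omega> f u = \<omega> (psi_inv u) * f (psi_inv u)"

lemma mellin_transport:
  shows "mellin_converges \<psi> \<omega> f p \<longleftrightarrow>
      set_integrable lebesgue {0<..} (\<lambda>u. complex_of_real u powr (p - 1) * transport \<omega> f u)"
    and "mellin \<psi> \<omega> f p = (LINT u:{0<..}|lebesgue. complex_of_real u powr (p - 1) * transport \<omega> f u)"
  unfolding mellin_converges_def mellin_def
  by (intro psi_substitution; simp add: mellin_integrand_def transport_def psi_inv_psi)+

text \<open>Under \<open>v = \<psi> s\<close> the point \<open>psi_inv (\<psi> x / \<psi> s)\<close>
  is where \<open>transport\<close> evaluates at \<open>\<psi> x / v\<close>, and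
  \<open>deriv \<psi> s / \<psi> s ds\<close> becomes \<open>dv / v\<close>.\<close>

lemma gconv_transport:
  assumes "x > 0"
  shows "gconv_converges \<psi> \<omega> f g x \<longleftrightarrow> set_integrable lebesgue {0<..}
      (\<lambda>v. transport \<omega> f v * transport \<omega> g (\<psi> x / v) / complex_of_real v)"
    and "gconv \<psi> \<omega> f g x = mult_convolution (transport \<omega> f) (transport \<omega> g) (\<psi> x) / \<omega> x"
proof -
  have *: "gconv_integrand \<psi> \<omega> f g x s = transport \<omega> f (\<psi> s) * transport \<omega> g (\<psi> x / \<psi> s)
      / complex_of_real (\<psi> s) * complex_of_real (deriv \<psi> s)" if "s > 0" for s
    using that by (simp add: gconv_integrand_def transport_def psi_inv_psi)
  show "gconv_converges \<psi> \<omega> f g x \<longleftrightarrow> set_integrable lebesgue {0<..}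
      (\<lambda>v. transport \<omega> f v * transport \<omega> g (\<psi> x / v) / complex_of_real v)"
    unfolding gconv_converges_def by (rule psi_substitution(1)) (rule *)
  have "(LINT s:{0<..}|lebesgue. gconv_integrand \<psi> \<omega> f g x s)
      = mult_convolution (transport \<omega> f) (transport \<omega> g) (\<psi> x)"
    unfolding mult_convolution_def by (rule psi_substitution(2)) (rule *)
  then show "gconv \<psi> \<omega> f g x = mult_convolution (transport \<omega> f) (transport \<omega> g) (\<psi> x) / \<omega> x"
    by (simp add: gconv_def)
qed

text \<open>The weight in \<open>transport\<close> cancels the factor \<open>1 / \<omega> x\<close>
  in \<open>gconv\<close>, because \<omega> does not vanish.\<close>

lemma transport_gconv:
  assumes "\<forall>x>0. \<omega> x \<noteq> 0" and "u > 0"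
  shows "transport \<omega> (gconv \<psi> \<omega> f g) u = mult_convolution (transport \<omega> f) (transport \<omega> g) u"
  using assms psi_psi_inv[of u] by (simp add: transport_def[of _ "gconv _ _ _ _"] gconv_transport(2))

section \<open>Weighted space, product formula and convergence almost everywhere\<close>

text \<open>At \<open>p = 1\<close> the power of \<open>\<psi> x\<close> equals 1; positivity of
  \<open>\<psi> x\<close> matters, since \<open>0 powr 0 = 0\<close>. What remains is integrability
  of \<open>h\<close>, that is, measurability and a finite norm integral.\<close>

lemma L1_space_iff_mellin_converges:
  assumes \<omega> [measurable]: "\<omega> \<in> borel_measurable (lebesgue_on {0<..})" and "\<forall>x>0. \<omega> x \<noteq> 0"
  shows "f \<in> L1_space \<omega> \<psi> \<longleftrightarrow> mellin_converges \<psi> \<omega> f 1"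
proof -
  note [measurable] = psi_deriv_measurable
  define h where "h x = \<omega> x * f x * complex_of_real (deriv \<psi> x)" for x
  have "mellin_converges \<psi> \<omega> f 1 \<longleftrightarrow> set_integrable lebesgue {0<..} h"
    unfolding mellin_converges_def
    by (intro set_integrable_cong) (auto simp: mellin_integrand_def h_def dest: psi_pos)
  also have "\<dots> \<longleftrightarrow> integrable (lebesgue_on {0<..}) h"
    by (simp add: set_integrable_def integrable_restrict_space)
  also have "\<dots> \<longleftrightarrow> h \<in> borel_measurable (lebesgue_on {0<..}) \<and>
      (\<integral>\<^sup>+x. ennreal (cmod (h x)) \<partial>lebesgue_on {0<..}) < \<infinity>"
    by (rule integrable_iff_bounded)
  also have "(\<integral>\<^sup>+x. ennreal (cmod (h x)) \<partial>lebesgue_on {0<..}) = L1_norm \<omega> \<psi> f"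
    unfolding L1_norm_def using psi_deriv(2)
    by (subst nn_integral_restrict_space)
      (auto intro!: nn_integral_cong simp: h_def norm_mult indicator_def less_imp_le)
  also have "h \<in> borel_measurable (lebesgue_on {0<..}) \<longleftrightarrow> f \<in> borel_measurable (lebesgue_on {0<..})"
  proof
    assume [measurable]: "f \<in> borel_measurable (lebesgue_on {0<..})"
    show "h \<in> borel_measurable (lebesgue_on {0<..})"
      unfolding h_def by measurable
  next
    assume [measurable]: "h \<in> borel_measurable (lebesgue_on {0<..})"
    \<comment> \<open>Measurability of \<open>f\<close> is recovered by dividing out the
      nonvanishing measurable factors.\<close>
    have "(\<lambda>x. h x / (\<omega> x * complex_of_real (deriv \<psi> x))) \<in> borel_measurable (lebesgue_on {0<..})"
      by measurable
    also have "?this \<longleftrightarrow> f \<in> borel_measurable (lebesgue_on {0<..})"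
      using assms(2) psi_deriv(2) by (intro measurable_cong) (force simp: h_def)
    finally show "f \<in> borel_measurable (lebesgue_on {0<..})" .
  qed
  finally show ?thesis
    by (simp add: L1_space_def)
qed

text \<open>After multiplication by \<open>u powr (p - 1)\<close>, the transported convolution is
  the multiplicative convolution of \<open>F f\<close> and \<open>F g\<close>, which are integrable
  by convergence at this \<open>p\<close>.\<close>

lemma mellin_gconv:
  assumes "\<forall>x>0. \<omega> x \<noteq> 0" "mellin_converges \<psi> \<omega> f p" "mellin_converges \<psi> \<omega> g p"
  shows "mellin_converges \<psi> \<omega> (gconv \<psi> \<omega> f g) p"
    and "mellin \<psi> \<omega> (gconv \<psi> \<omega> f g) p = mellin \<psi> \<omega> f p * mellin \<psi> \<omega> g p"
proof -
  define F where "F h u = complex_of_real u powr (p - 1) * transport \<omega> h u" for h u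
  have eq: "F (gconv \<psi> \<omega> f g) u = mult_convolution (F f) (F g) u" if "u \<in> {0<..}" for u
    using that assms(1) by (simp add: F_def[abs_def] transport_gconv mult_convolution_powr)
  note conv = mult_convolution_integrable[of "F f" "F g"]
  have int: "set_integrable lebesgue {0<..} (F f)" "set_integrable lebesgue {0<..} (F g)"
    using assms(2,3) by (simp_all add: mellin_transport F_def[abs_def])
  have "set_integrable lebesgue {0<..} (F (gconv \<psi> \<omega> f g))"
    using conv(2)[OF int] eq set_integrable_cong[of lebesgue lebesgue "{0<..}" "{0<..}"] by metis
  then show "mellin_converges \<psi> \<omega> (gconv \<psi> \<omega> f g) p"
    by (simp add: mellin_transport F_def[abs_def])
  have "(LINT u:{0<..}|lebesgue. F (gconv \<psi> \<omega> f g) u) =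
      (LINT u:{0<..}|lebesgue. mult_convolution (F f) (F g) u)"
    using eq by (intro set_lebesgue_integral_cong) auto
  then show "mellin \<psi> \<omega> (gconv \<psi> \<omega> f g) p = mellin \<psi> \<omega> f p * mellin \<psi> \<omega> g p"
    using conv(3)[OF int] by (simp add: mellin_transport F_def)
qed

text \<open>Fubini gives convergence for almost every \<open>u\<close>; \<open>psi_AE\<close> pulls
  the exceptional set back along \<open>u = \<psi> x\<close>.\<close>

lemma gconv_converges_AE:
  assumes "mellin_converges \<psi> \<omega> f 1" "mellin_converges \<psi> \<omega> g 1"
  shows "AE x in lebesgue_on {0<..}. gconv_converges \<psi> \<omega> f g x"
proof -
  have int: "set_integrable lebesgue {0<..} (transport \<omega> h)" if "mellin_converges \<psi> \<omega> h 1" for h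
  proof -
    have "set_integrable lebesgue {0<..} (\<lambda>u. complex_of_real u powr (1 - 1) * transport \<omega> h u)"
      using that by (simp only: mellin_transport)
    also have "?this \<longleftrightarrow> set_integrable lebesgue {0<..} (transport \<omega> h)"
      by (intro set_integrable_cong) auto
    finally show ?thesis .
  qed
  have "AE x\<in>{0<..} in lebesgue. set_integrable lebesgue {0<..}
      (\<lambda>v. transport \<omega> f v * transport \<omega> g (\<psi> x / v) / complex_of_real v)"
    by (rule psi_AE) (intro mult_convolution_integrable int assms)
  then have "AE x\<in>{0<..} in lebesgue. gconv_converges \<psi> \<omega> f g x"
    by eventually_elim (simp add: gconv_transport)
  then show ?thesis
    by (simp add: AE_restrict_space_iff)
qed

end

theorem theorem4p1:
  fixes \<psi> :: "real \<Rightarrow> real" and \<omega> f g :: "real \<Rightarrow> complex"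
  assumes "\<forall>x\<ge>0. \<exists>d>0. (\<psi> has_real_derivative d) (at x within {0..})"
    and "\<psi> 0 = 0"
    and "filterlim \<psi> at_top at_top"
    and "\<omega> \<in> L_infty"
    and "\<forall>x>0. \<omega> x \<noteq> 0"
    and "f \<in> L1_space \<omega> \<psi>"
    and "g \<in> L1_space \<omega> \<psi>"
  shows "(AE x in lebesgue_on {0<..}. gconv_converges \<psi> \<omega> f g x) \<and>
    gconv \<psi> \<omega> f g \<in> L1_space \<omega> \<psi> \<and>
    (\<forall>p::complex. mellin_converges \<psi> \<omega> f p \<longrightarrow> mellin_converges \<psi> \<omega> g p \<longrightarrow>
       mellin_converges \<psi> \<omega> (gconv \<psi> \<omega> f g) p \<and>
       mellin \<psi> \<omega> (gconv \<psi> \<omega> f g) p = mellin \<psi> \<omega> f p * mellin \<psi> \<omega> g p)"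
proof -
  note psi = assms(1-3)
  have "\<omega> \<in> borel_measurable (lebesgue_on {0<..})"
    using assms(4) by (simp add: L_infty_def)
  note L1 = L1_space_iff_mellin_converges[OF psi this assms(5)]
  \<comment> \<open>Through \<open>L1\<close>, the case \<open>p = 1\<close> of
    \<open>mellin_gconv\<close> also yields membership of the convolution.\<close>
  have "mellin_converges \<psi> \<omega> f 1" "mellin_converges \<psi> \<omega> g 1"
    using assms(6,7) by (simp_all add: L1)
  then show ?thesis
    using gconv_converges_AE[OF psi] mellin_gconv[OF psi assms(5)] by (simp add: L1)
qed

end
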